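(* For every positive integer $q$, with $t=(q^2+5q)/2$ and $n=3^q$, one can construct a $\overline{2}$-separable $t\times n$ Boolean matrix that has a time-optimal analysis algorithm (that is, one whose running time is $O(t)$, with the implied constant independent of $q$).
   Context: A $t\times n$ Boolean matrix $M$ models a non-adaptive group testing regimen: columns correspond to $n$ items, rows to $t$ tests, and test $r$ includes item $i$ iff $M[r,i]=1$. Given an unknown set of defective items, the outcome of a test is positive (1) if the test includes at least one defective item and negative (0) otherwise. $M$ is $\overline{d}$-separable if the Boolean sums (entrywise OR) of up to $d$ columns are all distinct, i.e. different sets of at most $d$ columns have different Boolean sums. An analysis algorithm for a $\overline{d}$-separable matrix takes as input the $t$ test outcomes arising from an unknown set of at most $d$ defective items and outputs that set (each item being output as the list of digits of its index). It is time-optimal if its running time is $O(t)$. *)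

theory Defs
  imports "Jordan_Normal_Form.Matrix"
begin

text \<open>Items are the columns \<open>0..<dim_col M\<close>, tests the rows. The Boolean sum of a set of columns
  is also the vector of test outcomes when exactly these items are defective.\<close>

definition boolean_sum :: "bool mat \<Rightarrow> nat set \<Rightarrow> bool vec" where
  "boolean_sum M S = vec (dim_row M) (\<lambda>r. \<exists>i\<in>S. M $$ (r, i))"

definition bar_separable :: "nat \<Rightarrow> bool mat \<Rightarrow> bool" where
  "bar_separable d M \<longleftrightarrow> inj_on (boolean_sum M) {S. S \<subseteq> {..<dim_col M} \<and> card S \<le> d}"

text \<open>The machine model is a unit-cost random access machine without multiplication. It has
  registers, an indirectly addressed memory, and a write-only output tape. It halts when the
  program counter leaves the program. Subtraction is truncated at 0.\<close>

datatype instr =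
    Const nat nat         \<comment> \<open>\<open>Const r k\<close>: register \<open>r\<close> becomes \<open>k\<close>\<close>
  | Move nat nat          \<comment> \<open>the first argument is the target, also for \<open>Add\<close>, \<open>Sub\<close> and \<open>Load\<close>\<close>
  | Add nat nat nat
  | Sub nat nat nat
  | Load nat nat          \<comment> \<open>\<open>Load r a\<close>: register \<open>a\<close> holds the address\<close>
  | Store nat nat         \<comment> \<open>\<open>Store a r\<close>: register \<open>a\<close> holds the address\<close>
  | Jump nat
  | JumpZero nat nat      \<comment> \<open>the last argument is the jump target\<close>
  | JumpLess nat nat nat
  | Out nat               \<comment> \<open>append the contents of the register to the output tape\<close>

type_synonym program = "instr list"

record ram =
  pc :: nat
  regs :: "nat \<Rightarrow> nat"
  mem :: "nat \<Rightarrow> nat"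
  outp :: "nat list"

definition set_reg :: "nat \<Rightarrow> nat \<Rightarrow> ram \<Rightarrow> ram" where
  "set_reg r v s = s\<lparr>pc := Suc (pc s), regs := (regs s)(r := v)\<rparr>"

definition branch :: "bool \<Rightarrow> nat \<Rightarrow> ram \<Rightarrow> ram" where
  "branch b l s = s\<lparr>pc := (if b then l else Suc (pc s))\<rparr>"

fun exec_instr :: "instr \<Rightarrow> ram \<Rightarrow> ram" where
  "exec_instr (Const r k) s = set_reg r k s"
| "exec_instr (Move r x) s = set_reg r (regs s x) s"
| "exec_instr (Add r x y) s = set_reg r (regs s x + regs s y) s"
| "exec_instr (Sub r x y) s = set_reg r (regs s x - regs s y) s"
| "exec_instr (Load r a) s = set_reg r (mem s (regs s a)) s"
| "exec_instr (Store a r) s = s\<lparr>pc := Suc (pc s), mem := (mem s)(regs s a := regs s r)\<rparr>"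
| "exec_instr (Jump l) s = branch True l s"
| "exec_instr (JumpZero r l) s = branch (regs s r = 0) l s"
| "exec_instr (JumpLess x y l) s = branch (regs s x < regs s y) l s"
| "exec_instr (Out r) s = s\<lparr>pc := Suc (pc s), outp := outp s @ [regs s r]\<rparr>"

definition halted :: "program \<Rightarrow> ram \<Rightarrow> bool" where
  "halted P s \<longleftrightarrow> length P \<le> pc s"

definition step :: "program \<Rightarrow> ram \<Rightarrow> ram" where
  "step P s = (if halted P s then s else exec_instr (P ! pc s) s)"

text \<open>The input occupies the first memory cells, and register 0 holds its length.\<close>

definition init :: "nat list \<Rightarrow> ram" where
  "init xs = \<lparr>pc = 0, regs = (\<lambda>_. 0)(0 := length xs),
     mem = (\<lambda>a. if a < length xs then xs ! a else 0), outp = []\<rparr>"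

definition run :: "program \<Rightarrow> nat list \<Rightarrow> nat \<Rightarrow> ram" where
  "run P xs k = (step P ^^ k) (init xs)"

definition words_bounded :: "nat \<Rightarrow> ram \<Rightarrow> bool" where
  "words_bounded B s \<longleftrightarrow> (\<forall>a. regs s a \<le> B \<and> mem s a \<le> B)"

text \<open>On input \<open>xs\<close>, program \<open>P\<close> halts with output \<open>ys\<close> after at most \<open>T\<close> steps and never holds
  a number greater than \<open>B\<close>. The bound \<open>B\<close> prevents parallel computation by unit-cost arithmetic
  on long numbers.\<close>

definition computes_within :: "program \<Rightarrow> nat \<Rightarrow> nat \<Rightarrow> nat list \<Rightarrow> nat list \<Rightarrow> bool" where
  "computes_within P T B xs ys \<longleftrightarrow>
     (\<exists>k\<le>T. halted P (run P xs k) \<and> outp (run P xs k) = ys \<and>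
        (\<forall>j\<le>k. words_bounded B (run P xs j)))"

text \<open>The \<open>q\<close> digits of \<open>i\<close> in radix \<open>b\<close>, most significant first, leading zeros included.\<close>

definition radix_digits :: "nat \<Rightarrow> nat \<Rightarrow> nat \<Rightarrow> nat list" where
  "radix_digits b q i = map (\<lambda>k. i div b ^ (q - 1 - k) mod b) [0..<q]"

definition outcomes :: "bool mat \<Rightarrow> nat set \<Rightarrow> nat list" where
  "outcomes M D = map of_bool (list_of_vec (boolean_sum M D))"

text \<open>The single program \<open>P\<close> analyses every matrix of the family. It outputs the defective items
  in any order, each item of \<open>M q\<close> as \<open>q\<close> digits in radix \<open>b\<close>. With \<open>t\<close> tests it takes at most
  \<open>c * t\<close> steps on words of \<open>log t + O(1)\<close> bits. If the program could depend on \<open>q\<close>, a decision tree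
  over the outcomes would decode any separable matrix in linear time.\<close>

definition time_optimal_analysis :: "nat \<Rightarrow> nat \<Rightarrow> (nat \<Rightarrow> bool mat) \<Rightarrow> program \<Rightarrow> bool" where
  "time_optimal_analysis d b M P \<longleftrightarrow>
     (\<exists>c. \<forall>q>0. \<forall>D. D \<subseteq> {..<dim_col (M q)} \<and> card D \<le> d \<longrightarrow>
        (\<exists>xs. distinct xs \<and> set xs = D \<and>
           computes_within P (c * dim_row (M q)) (c * dim_row (M q))
             (outcomes (M q) D) (concat (map (radix_digits b q) xs))))"

end

theory Submission
  imports Defs
begin

text \<open>The tests ask, for every position of the ternary index, which digits occur there, and, for
  every pair of positions, whether some defective item has equal digits at both. For two
  items let \<open>p0\<close> be the first position where two digits occur. Call the item with digit \<open>x\<close> there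
  the first one and let \<open>y\<close> be the digit of the other one and \<open>z\<close> the third digit. At a later
  position where two digits occur, put \<open>w = x\<close> if the pair test with \<open>p0\<close> is positive and
  \<open>w = y\<close> otherwise; then the first item has digit \<open>w\<close> if \<open>w\<close> occurs there, and \<open>z\<close> otherwise.
  Only tests with \<open>p0\<close> are read, in two passes over the outcomes. Separability is a consequence
  of the existence of the decoder, because a deterministic program has one output per input.\<close>

section \<open>Bounded execution\<close>

text \<open>A Hoare-style judgement with cost. \<open>T\<close> is an upper bound rather than an
  exact count, so that branches of different length share one judgement and segments compose by
  adding their bounds.\<close>

definition reaches :: "program \<Rightarrow> nat \<Rightarrow> nat \<Rightarrow> (ram \<Rightarrow> bool) \<Rightarrow> ram \<Rightarrow> bool" where
  "reaches P B T Q s \<longleftrightarrow>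
     (\<exists>k\<le>T. Q ((step P ^^ k) s) \<and> (\<forall>j\<le>k. words_bounded B ((step P ^^ j) s)))"

lemma reaches_mono:
  assumes "reaches P B T Q s" "T \<le> T'" "\<And>s'. Q s' \<Longrightarrow> R s'"
  shows "reaches P B T' R s"
  using assms unfolding reaches_def by (meson order_trans)

lemma reaches_refl: "words_bounded B s \<Longrightarrow> Q s \<Longrightarrow> reaches P B T Q s"
  unfolding reaches_def by (rule exI[of _ 0]) auto

lemma reaches_bind:
  assumes "reaches P B T Q s" "\<And>s'. Q s' \<Longrightarrow> reaches P B T' R s'"
  shows "reaches P B (T + T') R s"
proof -
  obtain k where k: "k \<le> T" "Q ((step P ^^ k) s)"
    "\<forall>j\<le>k. words_bounded B ((step P ^^ j) s)"
    using assms(1) unfolding reaches_def by blast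
  obtain l where l: "l \<le> T'" "R ((step P ^^ l) ((step P ^^ k) s))"
    "\<forall>j\<le>l. words_bounded B ((step P ^^ j) ((step P ^^ k) s))"
    using assms(2)[OF k(2)] unfolding reaches_def by blast
  have "words_bounded B ((step P ^^ j) s)" if "j \<le> l + k" for j
  proof (cases "j \<le> k")
    case False
    then have "j = (j - k) + k" "j - k \<le> l" using that by auto
    then show ?thesis using l(3) by (metis funpow_add comp_apply)
  qed (use k in auto)
  moreover have "R ((step P ^^ (l + k)) s)" using l(2) by (simp add: funpow_add)
  ultimately show ?thesis
    unfolding reaches_def using k(1) l(1) by (intro exI[of _ "l + k"]) auto
qed

text \<open>Recursion on the step count lets the simplifier execute one fixed path of a program
  instruction by instruction.\<close>

primrec exactly :: "program \<Rightarrow> nat \<Rightarrow> nat \<Rightarrow> (ram \<Rightarrow> bool) \<Rightarrow> ram \<Rightarrow> bool" where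
  "exactly P B 0 Q s \<longleftrightarrow> words_bounded B s \<and> Q s"
| "exactly P B (Suc k) Q s \<longleftrightarrow> words_bounded B s \<and> exactly P B k Q (step P s)"

lemma exactly_numeral:
  "exactly P B (numeral n) Q s \<longleftrightarrow>
     words_bounded B s \<and> exactly P B (pred_numeral n) Q (step P s)"
  by (simp add: numeral_eq_Suc)

lemma exactly_imp_reaches:
  assumes "exactly P B k Q s" "k \<le> T"
  shows "reaches P B T Q s"
proof -
  have "Q ((step P ^^ k) s) \<and> (\<forall>j\<le>k. words_bounded B ((step P ^^ j) s))"
    using assms(1)
  proof (induction k arbitrary: s)
    case (Suc k)
    have "words_bounded B ((step P ^^ j) s)" if "j \<le> Suc k" for j
      using that Suc by (cases j) (auto simp: funpow_swap1)
    then show ?case using Suc by (auto simp: funpow_swap1)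
  qed auto
  then show ?thesis unfolding reaches_def using assms(2) by blast
qed

lemma computes_within_iff_reaches:
  "computes_within P T B xs ys \<longleftrightarrow> reaches P B T (\<lambda>s. halted P s \<and> outp s = ys) (init xs)"
  unfolding computes_within_def reaches_def run_def by simp

lemma halted_run:
  assumes "halted P (run P xs k)" "k \<le> l"
  shows "run P xs l = run P xs k"
  using assms(2,1) by (induction rule: dec_induct) (simp_all add: run_def step_def)

text \<open>Both final states lie on the one run from \<open>init xs\<close>, and a halted state no
  longer changes.\<close>

lemma computes_within_unique:
  assumes "computes_within P T B xs ys" "computes_within P T' B' xs ys'"
  shows "ys = ys'"
proof -
  obtain k l where "halted P (run P xs k)" "outp (run P xs k) = ys"
    "halted P (run P xs l)" "outp (run P xs l) = ys'"
    using assms unfolding computes_within_def by blast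
  then show ?thesis by (metis halted_run nat_le_linear)
qed

section \<open>Radix digits\<close>

lemma length_radix_digits [simp]: "length (radix_digits b q i) = q"
  by (simp add: radix_digits_def)

text \<open>By induction on \<open>k\<close>, the lowest \<open>k\<close> digits determine the
  residue modulo \<open>b ^ k\<close>; for \<open>k = q\<close> the residue is the number
  itself.\<close>

lemma radix_digits_inj:
  assumes "i < b ^ q" "j < b ^ q" "radix_digits b q i = radix_digits b q j"
  shows "i = j"
proof -
  have digit: "i div b ^ k mod b = j div b ^ k mod b" if "k < q" for k
  proof -
    have "radix_digits b q i ! (q - 1 - k) = radix_digits b q j ! (q - 1 - k)"
      using assms(3) by simp
    then show ?thesis using that by (simp add: radix_digits_def)
  qed
  have "i mod b ^ k = j mod b ^ k" if "k \<le> q" for k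
    using that
  proof (induction k)
    case (Suc k)
    then show ?case using digit[of k] mod_mult2_eq[of _ "b ^ k" b]
      by (simp add: mult.commute)
  qed simp
  from this[of q] show ?thesis using assms(1,2) by simp
qed

text \<open>Each item contributes exactly \<open>q\<close> digits, so blocks can be split off from
  the front. For \<open>q = 0\<close> the number of items would be lost.\<close>

lemma concat_radix_digits_inj:
  assumes "q > 0" "set xs \<subseteq> {..<b ^ q}" "set ys \<subseteq> {..<b ^ q}"
    "concat (map (radix_digits b q) xs) = concat (map (radix_digits b q) ys)"
  shows "xs = ys"
  using assms(2-4)
proof (induction xs arbitrary: ys)
  case Nil
  then show ?case using \<open>q > 0\<close> by (cases ys) (auto dest: arg_cong[of _ _ length])
next
  case (Cons x xs)
  then obtain y zs where ys: "ys = y # zs"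
    using \<open>q > 0\<close> by (cases ys) (auto dest: arg_cong[of _ _ length])
  have "radix_digits b q x = radix_digits b q y"
    and tail: "concat (map (radix_digits b q) xs) = concat (map (radix_digits b q) zs)"
    using Cons.prems(3) by (simp_all add: ys)
  then have "x = y" using Cons.prems(1,2) by (intro radix_digits_inj[of x b q y]) (auto simp: ys)
  moreover have "xs = zs" using Cons.prems(1,2) tail by (intro Cons.IH) (auto simp: ys)
  ultimately show ?case by (simp add: ys)
qed

text \<open>Equal Boolean sums are the same input and so yield the same output, from which the items
  can be read off because \<open>q\<close> digits in radix \<open>b\<close> identify every
  column.\<close>

lemma time_optimal_analysis_separable:
  assumes "time_optimal_analysis d b M P" "q > 0" "dim_col (M q) \<le> b ^ q"
  shows "bar_separable d (M q)"
  unfolding bar_separable_def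
proof (rule inj_onI)
  fix D E
  assume D: "D \<in> {S. S \<subseteq> {..<dim_col (M q)} \<and> card S \<le> d}"
    and E: "E \<in> {S. S \<subseteq> {..<dim_col (M q)} \<and> card S \<le> d}"
    and eq: "boolean_sum (M q) D = boolean_sum (M q) E"
  obtain c where c: "\<exists>xs. distinct xs \<and> set xs = S \<and> computes_within P (c * dim_row (M q))
      (c * dim_row (M q)) (outcomes (M q) S) (concat (map (radix_digits b q) xs))"
    if "S \<subseteq> {..<dim_col (M q)} \<and> card S \<le> d" for S
    using assms(1,2) unfolding time_optimal_analysis_def by blast
  obtain xs where xs: "set xs = D" "computes_within P (c * dim_row (M q)) (c * dim_row (M q))
      (outcomes (M q) D) (concat (map (radix_digits b q) xs))"
    using c[of D] D by blast
  obtain ys where ys: "set ys = E" "computes_within P (c * dim_row (M q)) (c * dim_row (M q))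
      (outcomes (M q) E) (concat (map (radix_digits b q) ys))"
    using c[of E] E by blast
  have "outcomes (M q) D = outcomes (M q) E" using eq by (simp add: outcomes_def)
  then have "concat (map (radix_digits b q) xs) = concat (map (radix_digits b q) ys)"
    using computes_within_unique[OF xs(2)] ys(2) by metis
  moreover have "set xs \<subseteq> {..<b ^ q}" "set ys \<subseteq> {..<b ^ q}"
    using D E xs(1) ys(1) assms(3) by auto
  ultimately have "xs = ys" using concat_radix_digits_inj[OF \<open>q > 0\<close>] by metis
  then show "D = E" using xs(1) ys(1) by simp
qed

section \<open>The test matrix\<close>

text \<open>Position 0 is the most significant digit, as in the output order of
  \<open>radix_digits\<close>.\<close>

definition digit :: "nat \<Rightarrow> nat \<Rightarrow> nat \<Rightarrow> nat" where
  "digit q i p = i div 3 ^ (q - 1 - p) mod 3"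

text \<open>Row \<open>base p + v\<close> with \<open>v < 3\<close> tests whether digit \<open>p\<close> equals \<open>v\<close>, and row \<open>base p + 3 + j\<close>
  with \<open>j < p\<close> tests whether digits \<open>j\<close> and \<open>p\<close> agree. With this interleaving the decoder
  needs no knowledge of \<open>q\<close> beyond the length of its input.\<close>

definition base :: "nat \<Rightarrow> nat" where
  "base p = (\<Sum>j<p. j + 3)"

definition test_mat :: "nat \<Rightarrow> bool mat" where
  "test_mat q = mat (base q) (3 ^ q) (\<lambda>(r, i). \<exists>p<q.
     r = base p + digit q i p \<or> (\<exists>j<p. r = base p + 3 + j \<and> digit q i j = digit q i p))"

lemma base_0 [simp]: "base 0 = 0"
  and base_Suc [simp]: "base (Suc p) = base p + 3 + p"
  by (simp_all add: base_def)

lemma base_eq: "base q = (q\<^sup>2 + 5 * q) div 2"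
proof -
  \<comment> \<open>The doubled identity shows that the division by 2 is exact.\<close>
  have "2 * base q = q\<^sup>2 + 5 * q"
    by (induction q) (auto simp: power2_eq_square algebra_simps)
  then show ?thesis by simp
qed

lemma base_mono: "p \<le> q \<Longrightarrow> base p \<le> base q"
  unfolding base_def by (rule sum_mono2) auto

lemma base_block:
  assumes "p < q"
  shows "base p + 3 + p \<le> base q"
  using base_mono[of "Suc p" q] assms by simp

text \<open>This turns a running time linear in \<open>q\<close> into a multiple of the number of
  tests.\<close>

lemma base_ge: "3 * q \<le> base q"
  by (induction q) auto

lemma base_block_unique:
  assumes "base p + k = base p' + k'" "k < 3 + p" "k' < 3 + p'"
  shows "p = p' \<and> k = k'"
  using base_block[of p p'] base_block[of p' p] assms by (cases p p' rule: linorder_cases) auto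

lemma digit_less [simp]: "digit q i p < 3"
  by (simp add: digit_def)

text \<open>Within a block, offsets below 3 are digit rows and offsets from 3 on are pair rows. By
  \<open>base_block_unique\<close>, only the intended alternative of \<open>test_mat\<close> can
  produce this row.\<close>

lemma test_mat_digit:
  assumes "p < q" "i < 3 ^ q" "v < 3"
  shows "test_mat q $$ (base p + v, i) \<longleftrightarrow> digit q i p = v"
proof -
  have "base p + v < base q" using base_block[OF assms(1)] assms(3) by linarith
  then have "test_mat q $$ (base p + v, i) \<longleftrightarrow> (\<exists>p'<q. base p + v = base p' + digit q i p' \<or>
      (\<exists>j<p'. base p + v = base p' + 3 + j \<and> digit q i j = digit q i p'))"
    using assms(2) by (simp add: test_mat_def)
  also have "\<dots> \<longleftrightarrow> digit q i p = v"
  proof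
    assume "\<exists>p'<q. base p + v = base p' + digit q i p' \<or>
      (\<exists>j<p'. base p + v = base p' + 3 + j \<and> digit q i j = digit q i p')"
    then obtain p' where "base p + v = base p' + digit q i p' \<or>
      (\<exists>j<p'. base p + v = base p' + (3 + j))" by (auto simp: add.assoc)
    then show "digit q i p = v"
      using base_block_unique[of p v p'] assms(3) digit_less[of q i p']
      by (metis add_less_cancel_left less_add_same_cancel1 not_add_less1 trans_less_add1)
  qed (use assms in auto)
  finally show ?thesis .
qed

lemma test_mat_pair:
  assumes "p < q" "i < 3 ^ q" "j < p"
  shows "test_mat q $$ (base p + 3 + j, i) \<longleftrightarrow> digit q i j = digit q i p"
proof -
  have "base p + 3 + j < base q" using base_block[OF assms(1)] assms(3) by linarith
  then have "test_mat q $$ (base p + 3 + j, i) \<longleftrightarrow> (\<exists>p'<q. base p + 3 + j = base p' + digit q i p' \<or>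
      (\<exists>j'<p'. base p + 3 + j = base p' + 3 + j' \<and> digit q i j' = digit q i p'))"
    using assms(2) by (simp add: test_mat_def)
  also have "\<dots> \<longleftrightarrow> digit q i j = digit q i p"
  proof
    assume "\<exists>p'<q. base p + 3 + j = base p' + digit q i p' \<or>
      (\<exists>j'<p'. base p + 3 + j = base p' + 3 + j' \<and> digit q i j' = digit q i p')"
    \<comment> \<open>The offset \<open>k\<close> treats both kinds of row at once;
      \<open>k = 3 + j\<close> then rules out a digit row.\<close>
    then obtain p' k where p': "base p + (3 + j) = base p' + k" "k < 3 + p'"
      "k < 3 \<or> (\<exists>j'. k = 3 + j' \<and> digit q i j' = digit q i p')"
      by (smt (verit) add.assoc digit_less nat_add_left_cancel_less trans_less_add1)
    then show "digit q i j = digit q i p"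
      using base_block_unique[OF p'(1)] assms(3) by auto
  qed (use assms in auto)
  finally show ?thesis .
qed

section \<open>The decoder\<close>

text \<open>Registers: 0 the number of tests, 1 \<open>base p\<close>, 2 \<open>p\<close>, 3 and 4 the digits \<open>x\<close> and \<open>y\<close> of the
  current and the other item at their first difference \<open>p0\<close>, 5 the third digit, 6 \<open>p0\<close>,
  7 whether another item remains, 8, 15, 16 the constants 1, 2, 3, and 9 to 14 scratch, with
  13 and 14 the number and the sum of the digits that occur at position \<open>p\<close>.
  Instructions 3 to 23 look for \<open>p0\<close>; instructions 24 to 60 output one item.\<close>

definition decoder :: program where
  "decoder =
    [Const 8 1, Const 15 2, Const 16 3,
     JumpLess 1 0 5, Jump 24,
     Load 10 1, Add 9 1 8, Load 11 9, Add 9 9 8, Load 12 9, Add 14 11 12, Add 13 14 10, Add 14 14 12,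
     JumpZero 13 61, JumpLess 8 13 19,
     Add 1 1 16, Add 1 1 2, Add 2 2 8, Jump 3,
     Sub 3 8 10, Sub 4 14 3, Sub 5 16 14, Move 6 2, Const 7 1,
     Const 1 0, Const 2 0,
     JumpLess 1 0 33, JumpZero 7 61,
     Const 7 0, Move 9 3, Move 3 4, Move 4 9, Jump 24,
     Load 10 1, Add 9 1 8, Load 11 9, Add 9 9 8, Load 12 9, Add 14 11 12, Add 13 14 10, Add 14 14 12,
     JumpLess 13 15 56, JumpLess 6 2 45, Move 14 3, Jump 56,
     Add 9 1 16, Add 9 9 6, Load 9 9, Move 14 4, JumpZero 9 51, Move 14 3,
     Add 9 1 14, Load 9 9, JumpZero 9 55, Jump 56, Move 14 5,
     Out 14, Add 1 1 16, Add 1 1 2, Add 2 2 8, Jump 26]"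

section \<open>Symbolic execution of the decoder\<close>

lemma length_decoder: "length decoder = 61"
  by (simp add: decoder_def)

lemma step_decoder:
  "pc s < 61 \<Longrightarrow> step decoder s = exec_instr (decoder ! pc s) s"
  by (simp add: step_def halted_def length_decoder)

text \<open>Stated for a single function, so that each register update leaves only the new value to
  be bounded.\<close>

definition bounded_by :: "nat \<Rightarrow> (nat \<Rightarrow> nat) \<Rightarrow> bool" where
  "bounded_by B f \<longleftrightarrow> (\<forall>a. f a \<le> B)"

lemma words_bounded_iff: "words_bounded B s \<longleftrightarrow> bounded_by B (regs s) \<and> bounded_by B (mem s)"
  by (auto simp: words_bounded_def bounded_by_def)

lemma bounded_by_upd: "bounded_by B f \<Longrightarrow> v \<le> B \<Longrightarrow> bounded_by B (f(a := v))"
  by (simp add: bounded_by_def)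

text \<open>The program is unfolded only where an instruction is fetched, not inside
  \<open>step decoder\<close>.\<close>

lemmas decoder_nth = arg_cong[OF decoder_def, of "\<lambda>P. P ! i" for i]

lemmas decoder_exec = exactly_numeral step_decoder decoder_nth set_reg_def branch_def
  words_bounded_iff bounded_by_upd

text \<open>The invariant of both passes. The memory is a fixed parameter because the decoder has no
  \<open>Store\<close>.\<close>

definition scan_state :: "nat \<Rightarrow> nat \<Rightarrow> (nat \<Rightarrow> nat) \<Rightarrow> nat \<Rightarrow> nat list \<Rightarrow> ram \<Rightarrow> bool" where
  "scan_state B t m p ys s \<longleftrightarrow> bounded_by B (regs s) \<and> bounded_by B m \<and> mem s = m \<and>
     regs s 0 = t \<and> regs s 1 = base p \<and> regs s 2 = p \<and> regs s 8 = 1 \<and> regs s 15 = 2 \<and>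
     regs s 16 = 3 \<and> outp s = ys"

lemma scan_state_bounded: "scan_state B t m p ys s \<Longrightarrow> words_bounded B s"
  by (simp add: scan_state_def words_bounded_iff)

definition pair_state :: "nat \<Rightarrow> nat \<Rightarrow> nat \<Rightarrow> nat \<Rightarrow> nat \<Rightarrow> ram \<Rightarrow> bool" where
  "pair_state x y z p0 rest s \<longleftrightarrow>
     regs s 3 = x \<and> regs s 4 = y \<and> regs s 5 = z \<and> regs s 6 = p0 \<and> regs s 7 = rest"

section \<open>Memory contents that encode two items\<close>

text \<open>\<open>f\<close> and \<open>g\<close> are the digit sequences of the two items. A single
  item is the case \<open>f = g\<close>, so the same output loop serves both sizes.\<close>

locale encoded_pair =
  fixes q B :: nat and f g m :: "nat \<Rightarrow> nat"
  assumes base_le: "base q \<le> B"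
    and f_less: "f p < 3" and g_less: "g p < 3"
    and mem_digit: "p < q \<Longrightarrow> v < 3 \<Longrightarrow> m (base p + v) = of_bool (f p = v \<or> g p = v)"
    and mem_pair: "p < q \<Longrightarrow> j < p \<Longrightarrow> m (base p + 3 + j) = of_bool (f j = f p \<or> g j = g p)"
begin

lemma swap: "encoded_pair q B g f m"
  using base_le f_less g_less mem_digit mem_pair by unfold_locales (auto simp: disj_commute)

text \<open>The addresses have the normal form that symbolic execution of the increments
  yields.\<close>

lemma mem_digit_0: "p < q \<Longrightarrow> m (base p) = of_bool (f p = 0 \<or> g p = 0)"
  and mem_digit_1: "p < q \<Longrightarrow> m (Suc (base p)) = of_bool (f p = 1 \<or> g p = 1)"
  and mem_digit_2: "p < q \<Longrightarrow> m (Suc (Suc (base p))) = of_bool (f p = 2 \<or> g p = 2)"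
  using mem_digit[of p 0] mem_digit[of p 1] mem_digit[of p 2] by simp_all

lemma base_block_le:
  assumes "p < q"
  shows "base p + 3 + p \<le> base q" "base p + 3 + p \<le> B"
  using base_block[OF assms] base_le by auto

lemma digits_cases: "f p = 0 \<or> f p = 1 \<or> f p = 2" "g p = 0 \<or> g p = 1 \<or> g p = 2"
  using f_less[of p] g_less[of p] by linarith+

section \<open>First pass: the first position with two digits\<close>

lemma search_step:
  assumes "p < q" "f p = g p" "pc s = 3" "regs s 7 = 0" "scan_state B (base q) m p [] s"
  shows "reaches decoder B 15
    (\<lambda>s. pc s = 3 \<and> regs s 7 = 0 \<and> scan_state B (base q) m (Suc p) [] s) s"
proof -
  note S = assms(3-5)[unfolded scan_state_def] base_block_le[OF assms(1)]
  \<comment> \<open>Fixing the three loaded bits decides every branch of the 15 instructions of an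
    iteration.\<close>
  consider "m (base p) = 1" "m (Suc (base p)) = 0" "m (Suc (Suc (base p))) = 0"
    | "m (base p) = 0" "m (Suc (base p)) = 1" "m (Suc (Suc (base p))) = 0"
    | "m (base p) = 0" "m (Suc (base p)) = 0" "m (Suc (Suc (base p))) = 1"
    using mem_digit_0[OF assms(1)] mem_digit_1[OF assms(1)] mem_digit_2[OF assms(1)]
      digits_cases(1)[of p] assms(2) by auto
  then have "exactly decoder B 15
    (\<lambda>s. pc s = 3 \<and> regs s 7 = 0 \<and> scan_state B (base q) m (Suc p) [] s) s"
  proof cases
    case 1
    then show ?thesis using S by (simp add: decoder_exec scan_state_def)
  next
    case 2
    then show ?thesis using S by (simp add: decoder_exec scan_state_def)
  next
    case 3
    then show ?thesis using S by (simp add: decoder_exec scan_state_def)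
  qed
  then show ?thesis by (rule exactly_imp_reaches) simp
qed

lemma search_loop:
  assumes "n \<le> q" "\<forall>j<n. f j = g j" "pc s = 3" "regs s 7 = 0" "scan_state B (base q) m 0 [] s"
  shows "reaches decoder B (15 * n)
    (\<lambda>s. pc s = 3 \<and> regs s 7 = 0 \<and> scan_state B (base q) m n [] s) s"
  using assms(1,2)
proof (induction n)
  case 0
  then show ?case using assms(3-5) by (simp add: reaches_refl scan_state_bounded)
next
  case (Suc n)
  then have "reaches decoder B (15 * n + 15)
    (\<lambda>s. pc s = 3 \<and> regs s 7 = 0 \<and> scan_state B (base q) m (Suc n) [] s) s"
    by (intro reaches_bind[OF Suc.IH] search_step) auto
  then show ?case by (simp add: add.commute)
qed

text \<open>The smaller digit is 1 minus the outcome for digit 0. The other is the digit sum minus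
  the smaller, and the third is 3 minus the digit sum, since \<open>0 + 1 + 2 = 3\<close>.\<close>

lemma search_found:
  assumes "p < q" "f p < g p" "pc s = 3" "regs s 7 = 0" "scan_state B (base q) m p [] s"
  shows "reaches decoder B 16
    (\<lambda>s. pc s = 24 \<and> scan_state B (base q) m p [] s \<and>
       pair_state (f p) (g p) (3 - f p - g p) p 1 s) s"
proof -
  note S = assms(3-5)[unfolded scan_state_def] base_block_le[OF assms(1)]
  consider "f p = 0" "g p = 1" "m (base p) = 1" "m (Suc (base p)) = 1" "m (Suc (Suc (base p))) = 0"
    | "f p = 0" "g p = 2" "m (base p) = 1" "m (Suc (base p)) = 0" "m (Suc (Suc (base p))) = 1"
    | "f p = 1" "g p = 2" "m (base p) = 0" "m (Suc (base p)) = 1" "m (Suc (Suc (base p))) = 1"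
    using mem_digit_0[OF assms(1)] mem_digit_1[OF assms(1)] mem_digit_2[OF assms(1)]
      digits_cases[of p] assms(2) by auto
  then have "exactly decoder B 16
    (\<lambda>s. pc s = 24 \<and> scan_state B (base q) m p [] s \<and>
       pair_state (f p) (g p) (3 - f p - g p) p 1 s) s"
  proof cases
    case 1
    then show ?thesis using S by (simp add: decoder_exec scan_state_def pair_state_def)
  next
    case 2
    then show ?thesis using S by (simp add: decoder_exec scan_state_def pair_state_def)
  next
    case 3
    then show ?thesis using S by (simp add: decoder_exec scan_state_def pair_state_def)
  qed
  then show ?thesis by (rule exactly_imp_reaches) simp
qed

section \<open>Second pass: the digits of one item\<close>

lemma read_block:
  assumes "p < q" "pc s = 26" "scan_state B (base q) m p ys s" "pair_state x y z p0 rest s"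
  shows "reaches decoder B 9
    (\<lambda>s. pc s = 41 \<and> scan_state B (base q) m p ys s \<and> pair_state x y z p0 rest s \<and>
       regs s 13 = (if f p = g p then 1 else 2) \<and> regs s 14 = (if f p = g p then f p else f p + g p)) s"
proof -
  note S = assms(2,3)[unfolded scan_state_def] assms(4)[unfolded pair_state_def]
    base_block_le[OF assms(1)]
  define m0 m1 m2 where "m0 = m (base p)" and "m1 = m (Suc (base p))" and "m2 = m (Suc (Suc (base p)))"
  have sums: "m1 + m2 + m0 = (if f p = g p then 1 else 2)"
    "m1 + m2 + m2 = (if f p = g p then f p else f p + g p)"
    using mem_digit_0[OF assms(1)] mem_digit_1[OF assms(1)] mem_digit_2[OF assms(1)]
      digits_cases[of p] by (auto simp: m0_def m1_def m2_def)
  have "m0 \<le> 1" "m1 \<le> 1" "m2 \<le> 1"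
    using mem_digit_0[OF assms(1)] mem_digit_1[OF assms(1)] mem_digit_2[OF assms(1)]
    by (simp_all add: m0_def m1_def m2_def)
  then have "exactly decoder B 9
    (\<lambda>s. pc s = 41 \<and> scan_state B (base q) m p ys s \<and> pair_state x y z p0 rest s \<and>
       regs s 13 = m1 + m2 + m0 \<and> regs s 14 = m1 + m2 + m2) s"
    using S m0_def[symmetric] m1_def[symmetric] m2_def[symmetric]
    by (simp add: decoder_exec scan_state_def pair_state_def)
  then show ?thesis unfolding sums by (rule exactly_imp_reaches) simp
qed

text \<open>If only one digit occurs, it is already in register 14; at \<open>p0\<close> the digit
  is \<open>x\<close>; later the pair test with \<open>p0\<close> decides. The premise
  \<open>pivot\<close> is conditional, so a single item satisfies it vacuously.\<close>

lemma output_digit: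
  assumes "p < q" "pc s = 41" "scan_state B (base q) m p ys s" "pair_state x y z p0 rest s"
    and "regs s 13 = (if f p = g p then 1 else 2)" "regs s 14 = (if f p = g p then f p else f p + g p)"
    and pivot: "f p \<noteq> g p \<Longrightarrow> p0 \<le> p \<and> f p0 \<noteq> g p0 \<and> x = f p0 \<and> y = g p0 \<and> z = 3 - x - y"
  shows "reaches decoder B 17
    (\<lambda>s. pc s = 26 \<and> scan_state B (base q) m (Suc p) (ys @ [f p]) s \<and>
       pair_state x y z p0 rest s) s"
    (is "reaches _ _ _ ?Q _")
proof -
  note S = assms(2,3)[unfolded scan_state_def] assms(4)[unfolded pair_state_def]
    base_block_le[OF assms(1)] f_less[of p]
  consider (eq) "f p = g p" | (first) "f p \<noteq> g p" "p = p0" | (later) "f p \<noteq> g p" "p0 < p"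
    using pivot by force
  then show ?thesis
  proof cases
    case eq
    then have "regs s 13 = 1" "regs s 14 = f p" using assms(5,6) by auto
    then have "exactly decoder B 6 ?Q s"
      using S by (simp add: decoder_exec scan_state_def pair_state_def)
    then show ?thesis by (rule exactly_imp_reaches) simp
  next
    case first
    then have "regs s 13 = 2" "x = f p" using assms(5,7) by auto
    then have "exactly decoder B 9 ?Q s"
      using S first(2) by (simp add: decoder_exec scan_state_def pair_state_def)
    then show ?thesis by (rule exactly_imp_reaches) simp
  next
    case later
    have two: "regs s 13 = 2" using later assms(5) by simp
    have xy: "x = f p0" "y = g p0" "x \<noteq> y" "z = 3 - x - y" "x < 3" "y < 3"
      using assms(7)[OF later(1)] f_less[of p0] g_less[of p0] by auto
    have z_less: "z \<le> B" "x \<le> B" "y \<le> B" "base p + x \<le> B" "base p + y \<le> B"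
      using xy base_block_le[OF assms(1)] later by linarith+
    define e where "e \<longleftrightarrow> x = f p \<or> y = g p"
    have e: "m (base p + 3 + p0) = of_bool e"
      using mem_pair[OF assms(1) later(2)] xy by (simp add: e_def)
    have w: "m (base p + v) = of_bool (f p = v \<or> g p = v)" if "v < 3" for v
      using mem_digit[OF assms(1) that] .
    \<comment> \<open>A positive pair test means \<open>f p = x\<close> or \<open>g p = y\<close>.
      Then an \<open>x\<close> at \<open>p\<close> belongs to \<open>f\<close>, since
      \<open>g p = x\<close> would force \<open>f p = x\<close> as well; without \<open>x\<close>,
      \<open>g p = y\<close> and \<open>f p\<close> is the third digit. A negative test excludes
      \<open>f p = x\<close> and \<open>g p = y\<close>, so a \<open>y\<close> at \<open>p\<close>
      belongs to \<open>f\<close>, and without \<open>y\<close> again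
      \<open>f p = z\<close>.\<close>
    consider "m (base p + 3 + p0) = 1" "m (base p + x) = 1" "f p = x"
      | "m (base p + 3 + p0) = 1" "m (base p + x) = 0" "f p = z"
      | "m (base p + 3 + p0) = 0" "m (base p + y) = 1" "f p = y"
      | "m (base p + 3 + p0) = 0" "m (base p + y) = 0" "f p = z"
    proof (cases e; cases "f p = (if e then x else y) \<or> g p = (if e then x else y)")
      assume "e" "f p = (if e then x else y) \<or> g p = (if e then x else y)"
      then show ?thesis using that(1) e w[of x] xy later(1) by (auto simp: e_def)
    next
      assume "e" "\<not> (f p = (if e then x else y) \<or> g p = (if e then x else y))"
      moreover from this have "f p = z"
        using xy later(1) f_less[of p] unfolding e_def by auto
      ultimately show ?thesis using that(2) e w[of x] xy by auto
    next
      assume "\<not> e" "f p = (if e then x else y) \<or> g p = (if e then x else y)"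
      then show ?thesis using that(3) e w[of y] xy by (auto simp: e_def)
    next
      assume "\<not> e" "\<not> (f p = (if e then x else y) \<or> g p = (if e then x else y))"
      moreover from this have "f p = z"
        using xy f_less[of p] unfolding e_def by auto
      ultimately show ?thesis using that(4) e w[of y] xy by auto
    qed
    then show ?thesis
    proof cases
      case 1
      then have "exactly decoder B 17 ?Q s"
        using S two later(2) z_less by (simp add: decoder_exec scan_state_def pair_state_def)
      then show ?thesis by (rule exactly_imp_reaches) simp
    next
      case 2
      then have "exactly decoder B 17 ?Q s"
        using S two later(2) z_less by (simp add: decoder_exec scan_state_def pair_state_def)
      then show ?thesis by (rule exactly_imp_reaches) simp
    next
      case 3
      then have "exactly decoder B 16 ?Q s"
        using S two later(2) z_less by (simp add: decoder_exec scan_state_def pair_state_def)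
      then show ?thesis by (rule exactly_imp_reaches) simp
    next
      case 4
      then have "exactly decoder B 16 ?Q s"
        using S two later(2) z_less by (simp add: decoder_exec scan_state_def pair_state_def)
      then show ?thesis by (rule exactly_imp_reaches) simp
    qed
  qed
qed

lemma output_loop:
  assumes "n \<le> q" "pc s = 26" "scan_state B (base q) m 0 ys s" "pair_state x y z p0 rest s"
    and pivot: "\<And>p. p < q \<Longrightarrow> f p \<noteq> g p \<Longrightarrow>
      p0 \<le> p \<and> f p0 \<noteq> g p0 \<and> x = f p0 \<and> y = g p0 \<and> z = 3 - x - y"
  shows "reaches decoder B (26 * n)
    (\<lambda>s. pc s = 26 \<and> scan_state B (base q) m n (ys @ map f [0..<n]) s \<and>
       pair_state x y z p0 rest s) s"
  using assms(1)
proof (induction n)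
  case 0
  then show ?case using assms(2-4) by (simp add: reaches_refl scan_state_bounded)
next
  case (Suc n)
  then have n: "n < q" by simp
  \<comment> \<open>Reading a block takes 9 instructions; choosing and writing the digit takes at
    most 17.\<close>
  have "reaches decoder B (26 * n + (9 + 17))
    (\<lambda>s. pc s = 26 \<and> scan_state B (base q) m (Suc n) ((ys @ map f [0..<n]) @ [f n]) s \<and>
       pair_state x y z p0 rest s) s"
    using Suc.IH n pivot[OF n]
    by (intro reaches_bind[OF Suc.IH] reaches_bind[OF read_block[OF n]] output_digit) auto
  then show ?case by (simp add: add.commute)
qed

text \<open>Entering at 24 resets the scan to position 0, wherever the previous pass
  stopped.\<close>

lemma output_item:
  assumes "pc s = 24" "scan_state B (base q) m p ys s" "pair_state x y z p0 rest s"
    and pivot: "\<And>p. p < q \<Longrightarrow> f p \<noteq> g p \<Longrightarrow>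
      p0 \<le> p \<and> f p0 \<noteq> g p0 \<and> x = f p0 \<and> y = g p0 \<and> z = 3 - x - y"
  shows "reaches decoder B (2 + 26 * q)
    (\<lambda>s. pc s = 26 \<and> scan_state B (base q) m q (ys @ map f [0..<q]) s \<and>
       pair_state x y z p0 rest s) s"
proof -
  have "exactly decoder B 2
    (\<lambda>s. pc s = 26 \<and> scan_state B (base q) m 0 ys s \<and> pair_state x y z p0 rest s) s"
    using assms(1-3) by (simp add: decoder_exec scan_state_def pair_state_def)
  then have "reaches decoder B 2
    (\<lambda>s. pc s = 26 \<and> scan_state B (base q) m 0 ys s \<and> pair_state x y z p0 rest s) s"
    by (rule exactly_imp_reaches) simp
  then show ?thesis
    by (rule reaches_bind) (intro output_loop pivot; simp)
qed

lemma output_last: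
  assumes "pc s = 26" "scan_state B (base q) m q ys s" "pair_state x y z p0 0 s"
  shows "reaches decoder B 2 (\<lambda>s. halted decoder s \<and> outp s = ys) s"
proof -
  have "exactly decoder B 2 (\<lambda>s. halted decoder s \<and> outp s = ys) s"
    using assms by (simp add: decoder_exec scan_state_def pair_state_def halted_def length_decoder)
  then show ?thesis by (rule exactly_imp_reaches) simp
qed

text \<open>Exchanging \<open>x\<close> and \<open>y\<close> makes the same loop output the other
  item; \<open>z\<close> and \<open>p0\<close> are symmetric in the two items.\<close>

lemma output_swap:
  assumes "pc s = 26" "scan_state B (base q) m q ys s" "pair_state x y z p0 1 s" "x \<le> B" "y \<le> B"
  shows "reaches decoder B 7
    (\<lambda>s. pc s = 24 \<and> scan_state B (base q) m q ys s \<and> pair_state y x z p0 0 s) s"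
proof -
  have "exactly decoder B 7
    (\<lambda>s. pc s = 24 \<and> scan_state B (base q) m q ys s \<and> pair_state y x z p0 0 s) s"
    using assms by (simp add: decoder_exec scan_state_def pair_state_def)
  then show ?thesis by (rule exactly_imp_reaches) simp
qed

section \<open>Complete runs for one and two items\<close>

lemma decode_single:
  assumes "\<forall>j<q. f j = g j" "pc s = 3" "regs s 7 = 0" "scan_state B (base q) m 0 [] s"
  shows "reaches decoder B (41 * q + 6) (\<lambda>s. halted decoder s \<and> outp s = map f [0..<q]) s"
proof -
  \<comment> \<open>Registers 3 to 6 may hold anything here, since no position shows two digits.
    Register 7 is still 0, so no second item follows.\<close>
  have skip: "reaches decoder B 2 (\<lambda>s. pc s = 24 \<and> scan_state B (base q) m q [] s \<and>
      (\<exists>x y z p0. pair_state x y z p0 0 s)) s"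
    if "pc s = 3 \<and> regs s 7 = 0 \<and> scan_state B (base q) m q [] s" for s
  proof -
    have "exactly decoder B 2 (\<lambda>s. pc s = 24 \<and> scan_state B (base q) m q [] s \<and>
      (\<exists>x y z p0. pair_state x y z p0 0 s)) s"
      using that by (simp add: decoder_exec scan_state_def pair_state_def)
    then show ?thesis by (rule exactly_imp_reaches) simp
  qed
  have out: "reaches decoder B ((2 + 26 * q) + 2)
      (\<lambda>s. halted decoder s \<and> outp s = map f [0..<q]) s"
    if s: "pc s = 24 \<and> scan_state B (base q) m q [] s \<and> (\<exists>x y z p0. pair_state x y z p0 0 s)" for s
  proof -
    obtain x y z p0 where "pair_state x y z p0 0 s" using s by blast
    then have "reaches decoder B (2 + 26 * q) (\<lambda>s. pc s = 26 \<and>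
        scan_state B (base q) m q ([] @ map f [0..<q]) s \<and> pair_state x y z p0 0 s) s"
      using s assms(1) by (intro output_item) auto
    then show ?thesis by (rule reaches_bind) (auto intro: output_last)
  qed
  have "reaches decoder B (15 * q + (2 + ((2 + 26 * q) + 2)))
      (\<lambda>s. halted decoder s \<and> outp s = map f [0..<q]) s"
    by (rule reaches_bind[OF search_loop[OF order_refl assms]], rule reaches_bind[OF skip out])
  then show ?thesis by (rule reaches_mono) auto
qed

lemma decode_pair:
  assumes "p0 < q" "f p0 < g p0" "\<forall>j<p0. f j = g j"
    and "pc s = 3" "regs s 7 = 0" "scan_state B (base q) m 0 [] s"
  shows "reaches decoder B (67 * q + 29)
    (\<lambda>s. halted decoder s \<and> outp s = map f [0..<q] @ map g [0..<q]) s"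
proof -
  \<comment> \<open>The second output pass is the first with \<open>f\<close> and \<open>g\<close>
    exchanged.\<close>
  interpret swapped: encoded_pair q B g f m by (rule swap)
  define x y z where "x = f p0" and "y = g p0" and "z = 3 - x - y"
  have xy: "x \<le> B" "y \<le> B"
    using f_less[of p0] g_less[of p0] base_block_le[OF assms(1)] by (auto simp: x_def y_def)
  have first: "p0 \<le> p" if "f p \<noteq> g p" for p
    using that assms(3) not_le by blast
  have search: "reaches decoder B (15 * p0 + 16)
    (\<lambda>s. pc s = 24 \<and> scan_state B (base q) m p0 [] s \<and> pair_state x y z p0 1 s) s"
    unfolding x_def y_def z_def
    using assms by (intro reaches_bind[OF search_loop] search_found) auto
  have item1: "reaches decoder B (2 + 26 * q) (\<lambda>s. pc s = 26 \<and>
      scan_state B (base q) m q (map f [0..<q]) s \<and> pair_state x y z p0 1 s) s"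
    if "pc s = 24 \<and> scan_state B (base q) m p0 [] s \<and> pair_state x y z p0 1 s" for s
    using output_item[of s p0 "[]" x y z p0 1] that assms(2) first
    by (auto simp: x_def y_def z_def)
  have next_item: "reaches decoder B 7 (\<lambda>s. pc s = 24 \<and>
      scan_state B (base q) m q (map f [0..<q]) s \<and> pair_state y x z p0 0 s) s"
    if "pc s = 26 \<and> scan_state B (base q) m q (map f [0..<q]) s \<and> pair_state x y z p0 1 s" for s
    using that xy by (intro output_swap) auto
  have item2: "reaches decoder B (2 + 26 * q) (\<lambda>s. pc s = 26 \<and>
      scan_state B (base q) m q (map f [0..<q] @ map g [0..<q]) s \<and> pair_state y x z p0 0 s) s"
    if "pc s = 24 \<and> scan_state B (base q) m q (map f [0..<q]) s \<and> pair_state y x z p0 0 s" for s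
    using swapped.output_item[of s q "map f [0..<q]" y x z p0 0] that assms(2) first
    by (auto simp: x_def y_def z_def diff_right_commute)
  have last: "reaches decoder B 2
      (\<lambda>s. halted decoder s \<and> outp s = map f [0..<q] @ map g [0..<q]) s"
    if "pc s = 26 \<and> scan_state B (base q) m q (map f [0..<q] @ map g [0..<q]) s \<and>
      pair_state y x z p0 0 s" for s
    using that by (intro output_last) auto
  have "reaches decoder B (15 * p0 + 16 + (2 + 26 * q + (7 + (2 + 26 * q + 2))))
      (\<lambda>s. halted decoder s \<and> outp s = map f [0..<q] @ map g [0..<q]) s"
    by (intro reaches_bind[OF search] reaches_bind[OF item1] reaches_bind[OF next_item]
        reaches_bind[OF item2] last)
  then show ?thesis by (rule reaches_mono) (use assms(1) in auto)
qed

end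

section \<open>Initial state, empty set and correctness\<close>

lemma decoder_start:
  fixes xs :: "nat list"
  defines "m \<equiv> \<lambda>a. if a < length xs then xs ! a else 0"
  assumes "length xs \<le> B" "3 \<le> B" "\<forall>v \<in> set xs. v \<le> B"
  shows "reaches decoder B 3
    (\<lambda>s. pc s = 3 \<and> regs s 7 = 0 \<and> scan_state B (length xs) m 0 [] s) (init xs)"
proof -
  have "bounded_by B ((\<lambda>_. 0)(0 := length xs))" "bounded_by B m"
    using assms by (auto simp: bounded_by_def)
  then have "exactly decoder B 3
    (\<lambda>s. pc s = 3 \<and> regs s 7 = 0 \<and> scan_state B (length xs) m 0 [] s) (init xs)"
    using assms(3) by (simp add: decoder_exec init_def scan_state_def flip: m_def)
  then show ?thesis by (rule exactly_imp_reaches) simp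
qed

text \<open>A nonempty set shows a digit at position 0, so a zero count in the first block already
  identifies the empty set.\<close>

lemma decode_empty:
  assumes "t > 0" "3 \<le> B" "m 0 = 0" "m 1 = 0" "m 2 = 0" "pc s = 3" "scan_state B t m 0 [] s"
  shows "reaches decoder B 10 (\<lambda>s. halted decoder s \<and> outp s = []) s"
proof -
  have "exactly decoder B 10 (\<lambda>s. pc s = 61 \<and> outp s = []) s"
    using assms by (simp add: decoder_exec scan_state_def numeral_2_eq_2)
  then have "reaches decoder B 10 (\<lambda>s. pc s = 61 \<and> outp s = []) s"
    by (rule exactly_imp_reaches) simp
  then show ?thesis by (rule reaches_mono) (auto simp: halted_def length_decoder)
qed

lemma radix_digits_3: "radix_digits 3 q i = map (digit q i) [0..<q]"
  by (simp add: radix_digits_def digit_def)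

lemma test_mat_dim [simp]: "dim_row (test_mat q) = base q" "dim_col (test_mat q) = 3 ^ q"
  by (simp_all add: test_mat_def)

lemma length_outcomes [simp]: "length (outcomes M D) = dim_row M"
  by (simp add: outcomes_def boolean_sum_def)

lemma outcomes_nth: "r < dim_row M \<Longrightarrow> outcomes M D ! r = of_bool (\<exists>i\<in>D. M $$ (r, i))"
  by (simp add: outcomes_def boolean_sum_def list_of_vec_index)

lemma encoded_pair_outcomes:
  fixes a b q :: nat
  defines "m \<equiv> \<lambda>r. if r < base q then outcomes (test_mat q) {a, b} ! r else 0"
  assumes "base q \<le> B" "a < 3 ^ q" "b < 3 ^ q"
  shows "encoded_pair q B (digit q a) (digit q b) m"
proof
  show "m (base p + v) = of_bool (digit q a p = v \<or> digit q b p = v)" if "p < q" "v < 3" for p v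
    using that base_block[of p q] assms(3,4) by (simp add: m_def outcomes_nth test_mat_digit)
  show "m (base p + 3 + j) = of_bool (digit q a j = digit q a p \<or> digit q b j = digit q b p)"
    if "p < q" "j < p" for p j
    using that base_block[of p q] assms(3,4) test_mat_pair[of p q a j] test_mat_pair[of p q b j]
    by (simp add: m_def outcomes_nth)
qed (use assms in auto)

lemma small_set_cases:
  fixes D :: "nat set"
  assumes "finite D" "card D \<le> 2"
  obtains "D = {}" | i where "D = {i}" | a b where "D = {a, b}" "a \<noteq> b"
proof -
  consider "card D = 0" | "card D = 1" | "card D = 2" using assms(2) by linarith
  then show ?thesis using assms(1) that by cases (auto simp: card_1_singleton_iff card_2_iff)
qed

lemma decoder_correct:
  assumes q: "q > 0" and D: "D \<subseteq> {..<3 ^ q}" "card D \<le> 2"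
  shows "\<exists>xs. distinct xs \<and> set xs = D \<and> computes_within decoder (33 * base q) (33 * base q)
    (outcomes (test_mat q) D) (concat (map (radix_digits 3 q) xs))"
proof -
  define B where "B = 33 * base q"
  define m where "m = (\<lambda>r. if r < base q then outcomes (test_mat q) D ! r else 0)"
  have base_q: "3 * q \<le> base q" by (rule base_ge)
  have B: "base q \<le> B" "3 \<le> B" using base_q q by (auto simp: B_def)
  have "\<forall>v \<in> set (outcomes (test_mat q) D). v \<le> B"
    using B(2) by (auto simp: outcomes_def)
  then have start: "reaches decoder B 3
    (\<lambda>s. pc s = 3 \<and> regs s 7 = 0 \<and> scan_state B (base q) m 0 [] s) (init (outcomes (test_mat q) D))"
    using decoder_start[of "outcomes (test_mat q) D" B] B by (simp add: m_def)
  have finish: ?thesis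
    if "distinct xs" "set xs = D" "T \<le> 67 * q + 29"
      "\<And>s. pc s = 3 \<Longrightarrow> regs s 7 = 0 \<Longrightarrow> scan_state B (base q) m 0 [] s \<Longrightarrow>
         reaches decoder B T (\<lambda>s. halted decoder s \<and> outp s = concat (map (radix_digits 3 q) xs)) s"
    for xs T
  proof -
    have "reaches decoder B (3 + T)
      (\<lambda>s. halted decoder s \<and> outp s = concat (map (radix_digits 3 q) xs))
      (init (outcomes (test_mat q) D))"
      using that(4) by (intro reaches_bind[OF start]) auto
    \<comment> \<open>The total is at most \<open>67 * q + 32\<close>, hence at most
      \<open>99 * q\<close> as \<open>q > 0\<close>, and \<open>3 * q\<close> \<le>
      \<open>base q\<close> gives the factor 33.\<close>
    then have "reaches decoder B (33 * base q)
      (\<lambda>s. halted decoder s \<and> outp s = concat (map (radix_digits 3 q) xs))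
      (init (outcomes (test_mat q) D))"
      by (rule reaches_mono) (use that(3) base_q q in auto)
    then show ?thesis
      using that(1,2) unfolding computes_within_iff_reaches B_def by blast
  qed
  have encoded: "encoded_pair q B (digit q a) (digit q b) m" if "D = {a, b}" for a b
    unfolding m_def that using D that B by (intro encoded_pair_outcomes) auto
  have "finite D" using D(1) finite_subset by blast
  then show ?thesis
    using D(2)
  proof (cases rule: small_set_cases)
    case 1
    have "m 0 = 0" "m 1 = 0" "m 2 = 0"
      using base_q q by (auto simp: m_def 1 outcomes_nth)
    then show ?thesis
      using decode_empty[of "base q" B m] base_q q B 1
      by (intro finish[of "[]" 10]) auto
  next
    case (2 i)
    interpret encoded_pair q B "digit q i" "digit q i" m using encoded[of i i] 2 by simp
    show ?thesis
      using decode_single 2 q by (intro finish[of "[i]" "41 * q + 6"]) (auto simp: radix_digits_3)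
  next
    case (3 a b)
    have "\<exists>j<q. digit q a j \<noteq> digit q b j"
    proof (rule ccontr)
      assume "\<not> ?thesis"
      then have "radix_digits 3 q a = radix_digits 3 q b" by (simp add: radix_digits_3)
      then show False using radix_digits_inj[of a 3 q b] 3 D by auto
    qed
    then obtain p0 where p0: "p0 < q" "digit q a p0 \<noteq> digit q b p0"
      "\<forall>j<p0. digit q a j = digit q b j"
      using exists_least_iff[of "\<lambda>j. j < q \<and> digit q a j \<noteq> digit q b j"]
      by (metis order_less_trans)
    \<comment> \<open>\<open>c\<close> is the item with the smaller digit at \<open>p0\<close>,
      which the decoder outputs first.\<close>
    have ordered: ?thesis
      if "D = {c, d}" "c \<noteq> d" "digit q c p0 < digit q d p0" "\<forall>j<p0. digit q c j = digit q d j"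
      for c d
    proof -
      interpret encoded_pair q B "digit q c" "digit q d" m using encoded that(1) .
      show ?thesis
        using decode_pair[OF p0(1) that(3,4)] that(1,2)
        by (intro finish[of "[c, d]" "67 * q + 29"]) (auto simp: radix_digits_3)
    qed
    show ?thesis
    proof (cases "digit q a p0 < digit q b p0")
      case True
      then show ?thesis using ordered[of a b] 3 p0(3) by simp
    next
      case False
      then show ?thesis using ordered[of b a] 3 p0(2,3) by (simp add: insert_commute)
    qed
  qed
qed

theorem theorem3:
  shows "\<exists>M :: nat \<Rightarrow> bool mat.
    (\<forall>q>0. M q \<in> carrier_mat ((q\<^sup>2 + 5 * q) div 2) (3 ^ q) \<and> bar_separable 2 (M q)) \<and>
    (\<exists>P. time_optimal_analysis 2 3 M P)"
proof -
  have "time_optimal_analysis 2 3 test_mat decoder"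
    unfolding time_optimal_analysis_def test_mat_dim using decoder_correct by blast
  moreover from this have "bar_separable 2 (test_mat q)" if "q > 0" for q
    using that by (rule time_optimal_analysis_separable) simp
  moreover have "test_mat q \<in> carrier_mat ((q\<^sup>2 + 5 * q) div 2) (3 ^ q)" for q
    unfolding base_eq[symmetric] by (intro carrier_matI) simp_all
  ultimately show ?thesis by blast
qed

end
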